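(* Let $m\ge 1$ and let $N=\{\mathbf{n}_1,\dots,\mathbf{n}_l\}$ be any positive basis for $\mathbb{R}^m$. Define $\psi_\infty^N,\psi_1^N:\mathbb{R}^m\to\mathbb{R}$ by $$\psi_\infty^N(u):=\max_{i=1,\dots,l}\{\mathbf{n}_i^\top u\},\qquad \psi_1^N(u):=\sum_{i=1}^l\max\{\mathbf{n}_i^\top u,0\}.$$ Then each of the functions $\psi=\psi_\infty^N$ and $\psi=\psi_1^N$ satisfies the following: there exist an open neighbourhood $V$ of $0$ in $\mathbb{R}^m$ and scalars $\delta>0$, $\gamma>0$ such that (1) $\psi(0)=0$; (2) $\psi(u)\ge\delta>0$ for all $u\notin V$; (3) $\psi(u)\ge\gamma\|u\|_\infty$ for all $u\in V$.
   Context: A set of vectors $\{\mathbf{n}_1,\dots,\mathbf{n}_l\}\subset\mathbb{R}^m$ with $m+1\le l\le 2m$ is called a positive basis for $\mathbb{R}^m$ if and only if every $u\in\mathbb{R}^m$ can be expressed as a positive combination of these vectors, i.e. there exist $\alpha_i\ge 0$, $i=1,\dots,l$, with $u=\sum_{i=1}^l\alpha_i\mathbf{n}_i$. *)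

theory Defs
  imports "HOL-Analysis.Analysis"
begin

text \<open>A positive basis \<open>n\<^sub>1, \<dots>, n\<^sub>l\<close> is a family indexed by \<open>{1..l}\<close>, so that the sum in
  \<open>psi_one\<close> runs over indices. Values of \<open>n\<close> outside \<open>{1..l}\<close> are irrelevant, and the
  vectors need not be distinct; a set of \<open>l\<close> vectors is the case where they are.\<close>

definition positive_basis :: "nat \<Rightarrow> (nat \<Rightarrow> real ^ 'm) \<Rightarrow> bool" where
  "positive_basis l n \<longleftrightarrow>
     CARD('m) + 1 \<le> l \<and> l \<le> 2 * CARD('m) \<and>
     (\<forall>u. \<exists>\<alpha>. (\<forall>i\<in>{1..l}. \<alpha> i \<ge> 0) \<and> u = (\<Sum>i=1..l. \<alpha> i *\<^sub>R n i))"

definition psi_inf :: "nat \<Rightarrow> (nat \<Rightarrow> real ^ 'm) \<Rightarrow> real ^ 'm \<Rightarrow> real" where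
  "psi_inf l n u = (MAX i\<in>{1..l}. n i \<bullet> u)"

definition psi_one :: "nat \<Rightarrow> (nat \<Rightarrow> real ^ 'm) \<Rightarrow> real ^ 'm \<Rightarrow> real" where
  "psi_one l n u = (\<Sum>i=1..l. max (n i \<bullet> u) 0)"

end

theory Submission imports Defs begin

text \<open>If \<open>v = \<Sum>\<^sub>i \<alpha>\<^sub>i n\<^sub>i\<close> with \<open>\<alpha>\<^sub>i \<ge> 0\<close>, then \<open>v \<bullet> u \<le> (\<Sum>\<^sub>i \<alpha>\<^sub>i) \<psi>\<^sub>\<infinity>(u)\<close> for every \<open>u\<close>.
  Taking for \<open>v\<close> the finitely many vectors \<open>\<plusminus>b\<close> of the standard basis bounds \<open>\<parallel>u\<parallel>\<^sub>\<infinity>\<close> by a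
  multiple of \<open>\<psi>\<^sub>\<infinity>(u)\<close>, hence of \<open>\<psi>\<^sub>1(u)\<close>, globally; any infinity-norm ball then serves as \<open>V\<close>.\<close>

text \<open>\<open>l \<ge> 1\<close> keeps the index set nonempty; \<open>Max\<close> of the empty
  set is unspecified.\<close>

lemma psi_inf_zero: "l \<ge> 1 \<Longrightarrow> psi_inf l n 0 = 0"
  by (simp add: psi_inf_def)

lemma psi_one_zero: "psi_one l n 0 = 0"
  by (simp add: psi_one_def)

lemma inner_le_psi_inf: "i \<in> {1..l} \<Longrightarrow> n i \<bullet> u \<le> psi_inf l n u"
  unfolding psi_inf_def by (rule Max_ge) auto

lemma psi_inf_le_psi_one:
  assumes "l \<ge> 1"
  shows "psi_inf l n u \<le> psi_one l n u"
proof -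
  have "n i \<bullet> u \<le> psi_one l n u" if "i \<in> {1..l}" for i
  proof -
    have "max (n i \<bullet> u) 0 \<le> psi_one l n u"
      unfolding psi_one_def using that by (intro member_le_sum) auto
    then show ?thesis by simp
  qed
  then show ?thesis
    using assms unfolding psi_inf_def by (subst Max_le_iff) auto
qed

lemma positive_basis_inner_le_psi_inf:
  assumes "positive_basis l n"
  obtains s where "s \<ge> 0" "\<And>u. v \<bullet> u \<le> s * psi_inf l n u"
proof -
  obtain \<alpha> where \<alpha>: "\<And>i. i \<in> {1..l} \<Longrightarrow> \<alpha> i \<ge> 0" and v: "v = (\<Sum>i=1..l. \<alpha> i *\<^sub>R n i)"
    using assms unfolding positive_basis_def by blast
  have "v \<bullet> u \<le> (\<Sum>i=1..l. \<alpha> i) * psi_inf l n u" for u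
    unfolding v inner_sum_left sum_distrib_right
    \<comment> \<open>Termwise, \<open>n i \<bullet> u \<le> psi_inf l n u\<close> is scaled by
      \<open>\<alpha> i \<ge> 0\<close>, so the sign of \<open>psi_inf l n u\<close> is irrelevant
      here.\<close>
    by (intro sum_mono) (simp add: \<alpha> inner_le_psi_inf mult_left_mono)
  moreover have "(\<Sum>i=1..l. \<alpha> i) \<ge> 0"
    by (intro sum_nonneg \<alpha>)
  ultimately show thesis
    using that by blast
qed

text \<open>Apply the preceding bound with \<open>u\<close> itself as the combined vector: a
  negative value at \<open>u\<close> would give \<open>u \<bullet> u \<le> 0\<close>, hence
  \<open>u = 0\<close>, where the value is 0.\<close>

lemma positive_basis_psi_inf_nonneg:
  assumes "positive_basis l n"
  shows "psi_inf l n u \<ge> 0"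
proof (rule ccontr)
  assume neg: "\<not> ?thesis"
  obtain s where "s \<ge> 0" "\<And>w. u \<bullet> w \<le> s * psi_inf l n w"
    using positive_basis_inner_le_psi_inf[OF assms] by blast
  then have "u \<bullet> u \<le> 0"
    using neg by (meson mult_nonneg_nonpos nle_le order_trans)
  then have "u = 0"
    by (metis inner_gt_zero_iff not_less)
  moreover have "l \<ge> 1"
    using assms by (simp add: positive_basis_def)
  ultimately show False
    using neg by (simp add: psi_inf_zero)
qed

lemma positive_basis_psi_inf_ge_infnorm:
  fixes n :: "nat \<Rightarrow> real ^ 'm"
  assumes "positive_basis l n"
  obtains \<gamma> where "\<gamma> > 0" "\<And>u. psi_inf l n u \<ge> \<gamma> * infnorm u"
proof -
  have "\<exists>s\<ge>0. \<forall>u. v \<bullet> u \<le> s * psi_inf l n u" for v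
    using positive_basis_inner_le_psi_inf[OF assms] by metis
  then obtain s where s: "\<And>v. s v \<ge> 0" "\<And>v u. v \<bullet> u \<le> s v * psi_inf l n u"
    by metis
  \<comment> \<open>A common upper bound for the coefficients of all \<open>b\<close> and
    \<open>- b\<close>; the summand 1 makes \<open>C\<close> positive, hence invertible.\<close>
  define C where "C = 1 + (\<Sum>b\<in>Basis. s b + s (- b))"
  have sC: "s b \<le> C" "s (- b) \<le> C" if "b \<in> Basis" for b
  proof -
    have "s b + s (- b) \<le> (\<Sum>b\<in>Basis. s b + s (- b))"
      using that s(1) by (intro member_le_sum) auto
    then show "s b \<le> C" "s (- b) \<le> C"
      unfolding C_def using s(1)[of b] s(1)[of "- b"] by linarith+
  qed
  have "C > 0"
    unfolding C_def by (intro add_pos_nonneg sum_nonneg add_nonneg_nonneg s) simp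
  have "infnorm u \<le> C * psi_inf l n u" for u
  proof -
    have "\<bar>u \<bullet> b\<bar> \<le> C * psi_inf l n u" if b: "b \<in> Basis" for b
    proof -
      have "b \<bullet> u \<le> C * psi_inf l n u" "(- b) \<bullet> u \<le> C * psi_inf l n u"
        \<comment> \<open>Enlarging \<open>s b\<close> and \<open>s (- b)\<close> to
          \<open>C\<close> preserves the bounds because \<open>psi_inf\<close> is
          nonnegative.\<close>
        using s(2) sC[OF b] positive_basis_psi_inf_nonneg[OF assms]
        by (meson mult_right_mono order_trans)+
      then show ?thesis
        by (simp add: inner_commute)
    qed
    then show ?thesis
      unfolding infnorm_Max by (subst Max_le_iff) auto
  qed
  then have "psi_inf l n u \<ge> inverse C * infnorm u" for u
    using \<open>C > 0\<close> by (simp add: field_simps)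
  then show thesis
    using that \<open>C > 0\<close> by (metis inverse_positive_iff_positive)
qed

text \<open>\<open>V\<close> is the open unit ball of \<open>infnorm\<close>. Outside it
  \<open>infnorm u \<ge> 1\<close>, so \<open>\<gamma>\<close> itself serves as
  \<open>\<delta>\<close>.\<close>

lemma infnorm_lower_bound_imp_local:
  fixes \<psi> :: "real ^ 'm \<Rightarrow> real"
  assumes "\<gamma> > 0" "\<psi> 0 = 0" "\<And>u. \<psi> u \<ge> \<gamma> * infnorm u"
  shows "\<exists>V \<delta> \<gamma>. open V \<and> 0 \<in> V \<and> \<delta> > 0 \<and> \<gamma> > 0 \<and> \<psi> 0 = 0 \<and>
           (\<forall>u. u \<notin> V \<longrightarrow> \<psi> u \<ge> \<delta>) \<and> (\<forall>u\<in>V. \<psi> u \<ge> \<gamma> * infnorm u)"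
proof (intro exI conjI)
  show "open {u :: real ^ 'm. infnorm u < 1}"
    by (intro open_Collect_less continuous_intros)
  show "\<forall>u. u \<notin> {u. infnorm u < 1} \<longrightarrow> \<psi> u \<ge> \<gamma>"
  proof (intro allI impI)
    fix u :: "real ^ 'm"
    assume "u \<notin> {u. infnorm u < 1}"
    then have "\<gamma> \<le> \<gamma> * infnorm u"
      using assms(1) by simp
    then show "\<psi> u \<ge> \<gamma>"
      using assms(3)[of u] by linarith
  qed
qed (use assms in \<open>auto simp: infnorm_0\<close>)

theorem proposition7:
  fixes n :: "nat \<Rightarrow> real ^ 'm" and l :: nat
  assumes "positive_basis l n"
  shows "\<forall>\<psi>\<in>{psi_inf l n, psi_one l n}.
           \<exists>V \<delta> \<gamma>. open V \<and> 0 \<in> V \<and> \<delta> > 0 \<and> \<gamma> > 0 \<and>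
             \<psi> 0 = 0 \<and>
             (\<forall>u. u \<notin> V \<longrightarrow> \<psi> u \<ge> \<delta>) \<and>
             (\<forall>u\<in>V. \<psi> u \<ge> \<gamma> * infnorm u)"
proof
  fix \<psi>
  assume \<psi>: "\<psi> \<in> {psi_inf l n, psi_one l n}"
  have l: "l \<ge> 1"
    using assms by (simp add: positive_basis_def)
  obtain \<gamma> where "\<gamma> > 0" and \<gamma>: "\<And>u. psi_inf l n u \<ge> \<gamma> * infnorm u"
    using positive_basis_psi_inf_ge_infnorm[OF assms] by blast
  \<comment> \<open>\<open>psi_one\<close> dominates \<open>psi_inf\<close>, so one
    \<open>\<gamma>\<close> serves both functions.\<close>
  have "\<psi> u \<ge> \<gamma> * infnorm u" for u
    using \<psi> \<gamma>[of u] psi_inf_le_psi_one[OF l, of n u] by auto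
  moreover have "\<psi> 0 = 0"
    using \<psi> psi_inf_zero[OF l] psi_one_zero by auto
  ultimately show "\<exists>V \<delta> \<gamma>. open V \<and> 0 \<in> V \<and> \<delta> > 0 \<and> \<gamma> > 0 \<and> \<psi> 0 = 0 \<and>
      (\<forall>u. u \<notin> V \<longrightarrow> \<psi> u \<ge> \<delta>) \<and> (\<forall>u\<in>V. \<psi> u \<ge> \<gamma> * infnorm u)"
    by (intro infnorm_lower_bound_imp_local[OF \<open>\<gamma> > 0\<close>])
qed

end
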